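(* Let $Y(\mathbb{R}^n)$ be a translation-invariant Banach function space and $w$ a weight with $w\in Y_{\rm loc}(\mathbb{R}^n)$ and $1/w\in Y'_{\rm loc}(\mathbb{R}^n)$. Suppose there exist $R>0$, $\varepsilon>0$ and $C_\varepsilon>0$ such that \[ \frac{w(x+y)}{w(x)}\le C_\varepsilon\quad\text{for all } |x|\ge R,\ |y|\le\varepsilon. \] Then there exists a constant $C>0$ such that for every $\kappa\in L^\infty(\mathbb{R}^n)$ with $\operatorname{supp}\kappa\subseteq B(0,\varepsilon)$ and every $f\in Y(\mathbb{R}^n,w)$, \[ \|\kappa*f\|_{Y(\mathbb{R}^n,w)}\le C\|\kappa\|_{L^\infty(\mathbb{R}^n)}\|f\|_{Y(\mathbb{R}^n,w)}. \]
   Context: Banach function spaces: let $\mathfrak{M}^+(\mathbb{R}^n)$ be the set of measurable functions with values in $[0,\infty]$. A Banach function norm $\rho:\mathfrak{M}^+\to[0,\infty]$ satisfies, for all $f,g,f_j\in\mathfrak{M}^+$, $a\ge0$, measurable $E$: (A1) $\rho(f)=0\iff f=0$ a.e., $\rho(af)=a\rho(f)$, $\rho(f+g)\le\rho(f)+\rho(g)$; (A2) $0\le g\le f$ a.e. implies $\rho(g)\le\rho(f)$; (A3) $0\le f_j\uparrow f$ a.e. implies $\rho(f_j)\uparrow\rho(f)$; (A4) $|E|<\infty$ implies $\rho(\chi_E)<\infty$; (A5) $|E|<\infty$ implies $\int_Ef\le C_E\rho(f)$ with $C_E$ independent of $f$. $Y(\mathbb{R}^n)$ is the set of measurable complex $f$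 with $\rho(|f|)<\infty$, $\|f\|_Y=\rho(|f|)$. The associate space $Y'$ is given by the norm $\rho'(g)=\sup\{\int fg: f\in\mathfrak{M}^+,\rho(f)\le1\}$. $Y$ is translation-invariant if $\|u(\cdot-y)\|_Y=\|u\|_Y$ for all $y$, $u\in Y$. $f\in Y_{\rm loc}$ means $f\chi_E\in Y$ for every measurable $E$ of finite measure (similarly $Y'_{\rm loc}$). A weight is a measurable $w$ with $0<w<\infty$ a.e.; $Y(\mathbb{R}^n,w)=\{f: fw\in Y\}$ with $\|f\|_{Y(\mathbb{R}^n,w)}=\|fw\|_Y$. $B(0,\varepsilon)$ is the open ball of radius $\varepsilon$ centered at $0$. *)

theory Defs
  imports "HOL-Analysis.Analysis"
begin

text \<open>Functions on R^n are modelled on an arbitrary Euclidean space 'a with Lebesgue measure.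
  The class M^+ is borel_measurable lebesgue with values in ennreal (= [0,\<infinity>]).\<close>

definition banach_function_norm :: "(('a::euclidean_space \<Rightarrow> ennreal) \<Rightarrow> ennreal) \<Rightarrow> bool" where
  "banach_function_norm \<rho> \<longleftrightarrow>
    \<comment> \<open>(A1)\<close>
    (\<forall>f \<in> borel_measurable lebesgue. \<rho> f = 0 \<longleftrightarrow> (AE x in lebesgue. f x = 0)) \<and>
    (\<forall>f \<in> borel_measurable lebesgue. \<forall>a::real. a \<ge> 0 \<longrightarrow>
        \<rho> (\<lambda>x. ennreal a * f x) = ennreal a * \<rho> f) \<and>
    (\<forall>f \<in> borel_measurable lebesgue. \<forall>g \<in> borel_measurable lebesgue.
        \<rho> (\<lambda>x. f x + g x) \<le> \<rho> f + \<rho> g) \<and>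
    \<comment> \<open>(A2)\<close>
    (\<forall>f \<in> borel_measurable lebesgue. \<forall>g \<in> borel_measurable lebesgue.
        (AE x in lebesgue. g x \<le> f x) \<longrightarrow> \<rho> g \<le> \<rho> f) \<and>
    \<comment> \<open>(A3)\<close>
    (\<forall>F f. (\<forall>j. F j \<in> borel_measurable lebesgue) \<longrightarrow> f \<in> borel_measurable lebesgue \<longrightarrow>
        (AE x in lebesgue. incseq (\<lambda>j. F j x) \<and> (\<lambda>j. F j x) \<longlonglongrightarrow> f x) \<longrightarrow>
        incseq (\<lambda>j. \<rho> (F j)) \<and> (\<lambda>j. \<rho> (F j)) \<longlonglongrightarrow> \<rho> f) \<and>
    \<comment> \<open>(A4)\<close>
    (\<forall>E \<in> sets lebesgue. emeasure lebesgue E < \<infinity> \<longrightarrow> \<rho> (indicator E) < \<infinity>) \<and>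
    \<comment> \<open>(A5)\<close>
    (\<forall>E \<in> sets lebesgue. emeasure lebesgue E < \<infinity> \<longrightarrow>
        (\<exists>C::real. \<forall>f \<in> borel_measurable lebesgue.
            (\<integral>\<^sup>+ x \<in> E. f x \<partial>lebesgue) \<le> ennreal C * \<rho> f))"

definition Ynorm :: "(('a::euclidean_space \<Rightarrow> ennreal) \<Rightarrow> ennreal) \<Rightarrow> ('a \<Rightarrow> complex) \<Rightarrow> ennreal" where
  "Ynorm \<rho> f = \<rho> (\<lambda>x. ennreal (cmod (f x)))"

definition Yspace :: "(('a::euclidean_space \<Rightarrow> ennreal) \<Rightarrow> ennreal) \<Rightarrow> ('a \<Rightarrow> complex) set" where
  "Yspace \<rho> = {f \<in> borel_measurable lebesgue. Ynorm \<rho> f < \<infinity>}"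

definition assoc_norm :: "(('a::euclidean_space \<Rightarrow> ennreal) \<Rightarrow> ennreal) \<Rightarrow> ('a \<Rightarrow> ennreal) \<Rightarrow> ennreal" where
  "assoc_norm \<rho> g = (SUP f \<in> {f \<in> borel_measurable lebesgue. \<rho> f \<le> 1}. \<integral>\<^sup>+ x. f x * g x \<partial>lebesgue)"

definition translation_invariant :: "(('a::euclidean_space \<Rightarrow> ennreal) \<Rightarrow> ennreal) \<Rightarrow> bool" where
  "translation_invariant \<rho> \<longleftrightarrow> (\<forall>u \<in> Yspace \<rho>. \<forall>y. Ynorm \<rho> (\<lambda>x. u (x - y)) = Ynorm \<rho> u)"

definition Yloc :: "(('a::euclidean_space \<Rightarrow> ennreal) \<Rightarrow> ennreal) \<Rightarrow> ('a \<Rightarrow> complex) \<Rightarrow> bool" where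
  "Yloc \<rho> f \<longleftrightarrow> (\<forall>E \<in> sets lebesgue. emeasure lebesgue E < \<infinity> \<longrightarrow>
      (\<lambda>x. f x * indicator E x) \<in> Yspace \<rho>)"

definition Yassoc_loc :: "(('a::euclidean_space \<Rightarrow> ennreal) \<Rightarrow> ennreal) \<Rightarrow> ('a \<Rightarrow> complex) \<Rightarrow> bool" where
  "Yassoc_loc \<rho> f \<longleftrightarrow> (\<forall>E \<in> sets lebesgue. emeasure lebesgue E < \<infinity> \<longrightarrow>
      (\<lambda>x. f x * indicator E x) \<in> borel_measurable lebesgue \<and>
      assoc_norm \<rho> (\<lambda>x. ennreal (cmod (f x * indicator E x))) < \<infinity>)"

definition is_weight :: "('a::euclidean_space \<Rightarrow> real) \<Rightarrow> bool" where
  "is_weight w \<longleftrightarrow> w \<in> borel_measurable lebesgue \<and> (AE x in lebesgue. 0 < w x)"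

definition Yw_space :: "(('a::euclidean_space \<Rightarrow> ennreal) \<Rightarrow> ennreal) \<Rightarrow> ('a \<Rightarrow> real) \<Rightarrow> ('a \<Rightarrow> complex) set" where
  "Yw_space \<rho> w = {f. (\<lambda>x. f x * complex_of_real (w x)) \<in> Yspace \<rho>}"

definition Yw_norm :: "(('a::euclidean_space \<Rightarrow> ennreal) \<Rightarrow> ennreal) \<Rightarrow> ('a \<Rightarrow> real) \<Rightarrow> ('a \<Rightarrow> complex) \<Rightarrow> ennreal" where
  "Yw_norm \<rho> w f = Ynorm \<rho> (\<lambda>x. f x * complex_of_real (w x))"

definition Linf :: "('a::euclidean_space \<Rightarrow> complex) set" where
  "Linf = {k \<in> borel_measurable lebesgue. \<exists>C::real. AE x in lebesgue. cmod (k x) \<le> C}"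

definition Linf_norm :: "('a::euclidean_space \<Rightarrow> complex) \<Rightarrow> real" where
  "Linf_norm k = Inf {C::real. 0 \<le> C \<and> (AE x in lebesgue. cmod (k x) \<le> C)}"

definition conv :: "('a::euclidean_space \<Rightarrow> complex) \<Rightarrow> ('a \<Rightarrow> complex) \<Rightarrow> 'a \<Rightarrow> complex" where
  "conv k f x = (LINT y|lebesgue. k (x - y) * f y)"

end

theory Submission
  imports Defs
begin

text \<open>
  Pointwise, \<open>\<bar>\<kappa> * f\<bar>\<close> is at most \<open>\<parallel>\<kappa>\<parallel>\<close> times the integral of \<open>\<bar>f\<bar>\<close> over a ball of radius \<open>\<epsilon>\<close> around the point.
  Where \<open>\<bar>x\<bar> \<ge> R + \<epsilon>\<close>, the growth condition moves the weight inside this integral, so that the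
  Minkowski inequality \<open>\<rho> (\<mu> * H) \<le> \<mu> (R^n) \<rho> H\<close> applies to \<open>H = \<bar>f\<bar> w\<close>; on the remaining ball, Hoelder's
  inequality for \<open>\<rho>\<close> and the associate norm suffices.

  The Minkowski inequality is obtained without duality. For bounded \<open>H\<close> of bounded support, replacing \<open>y\<close> in
  \<open>\<integral> H (x - y) d\<mu>(y)\<close> by simple functions \<open>s\<^sub>i y\<close> converging to \<open>y\<close> gives finite combinations
  of translates of \<open>H\<close>. By continuity of translations in \<open>L\<^sup>1\<close> these converge to \<open>\<mu> * H\<close> in \<open>L\<^sup>1\<close>, hence a.e. along a
  subsequence, and the Fatou property of \<open>\<rho>\<close> passes the bound to the limit. Monotone convergence then gives
  general \<open>H\<close>.
\<close>

subsection \<open>Continuity of translations in \<open>L\<^sup>1\<close>\<close>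

lemma integrable_lborel_bounded_support:
  fixes f :: "'a::euclidean_space \<Rightarrow> real"
  assumes [measurable]: "f \<in> borel_measurable borel"
    and bound: "\<And>x. \<bar>f x\<bar> \<le> M" and supp: "\<And>x. norm x > K \<Longrightarrow> f x = 0"
  shows "integrable lborel f"
proof (rule Bochner_Integration.integrable_bound)
  show "integrable lborel (\<lambda>x::'a. M * indicator (cball 0 K) x :: real)"
    using emeasure_bounded_finite[of "cball (0::'a) K"] by (auto simp: less_top)
  show "AE x in lborel. norm (f x) \<le> norm (M * indicator (cball 0 K) x)"
  proof (rule AE_I2)
    fix x
    show "norm (f x) \<le> norm (M * indicator (cball 0 K) x)"
    proof (cases "norm x > K")
      case False
      have "\<bar>f x\<bar> \<le> \<bar>M\<bar>" using bound[of x] by linarith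
      with False show ?thesis by simp
    qed (simp add: supp)
  qed
qed simp

lemma integral_lborel_translate:
  fixes f :: "'a::euclidean_space \<Rightarrow> real"
  assumes [measurable]: "f \<in> borel_measurable borel"
  shows "(LINT x|lborel. f (x - u)) = (LINT x|lborel. f x)"
proof -
  have "(LINT x|lborel. f x) = (LINT x|distr lborel borel ((+) (- u)). f x)"
    by (simp only: lborel_distr_plus)
  also have "\<dots> = (LINT x|lborel. f (- u + x))"
    by (rule integral_distr) auto
  finally show ?thesis by simp
qed

text \<open>A measurable function is an a.e. limit of continuous functions. Clipped and cut off,
  these are dominated by a multiple of the indicator of one ball, so dominated convergence upgrades
  a.e. convergence to convergence in L^1.\<close>

lemma ex_continuous_L1_close:
  fixes h :: "'a::euclidean_space \<Rightarrow> real"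
  assumes [measurable]: "h \<in> borel_measurable borel"
    and bound: "\<And>x. 0 \<le> h x" "\<And>x. h x \<le> M" and supp: "\<And>x. norm x > K \<Longrightarrow> h x = 0"
    and "e > 0"
  obtains \<phi> where "continuous_on UNIV \<phi>" "\<And>x. \<bar>\<phi> x\<bar> \<le> M" "\<And>x. norm x > K + 1 \<Longrightarrow> \<phi> x = 0"
    "(LINT x|lborel. \<bar>\<phi> x - h x\<bar>) < e"
proof -
  have M: "0 \<le> M" using bound[of 0] by linarith
  have "h \<in> borel_measurable lebesgue"
    by (rule measurable_completion) measurable
  then have "h measurable_on UNIV"
    by (subst measurable_on_iff_borel_measurable) (simp_all add: lebesgue_on_UNIV_eq)
  then obtain N g where N: "negligible N" and g: "\<And>n. continuous_on UNIV (g n)"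
    and lim: "\<And>x. x \<notin> N \<Longrightarrow> (\<lambda>n. g n x) \<longlonglongrightarrow> h x"
    unfolding measurable_on_def by auto
  \<comment> \<open>Clipping to \<open>[0, M]\<close> does not disturb the limit, since
    \<open>h\<close> takes its values there. The second factor is 1 where
    \<open>norm x \<le> K\<close> and 0 where \<open>norm x \<ge> K + 1\<close>; being continuous it
    needs this transition layer, hence the radius \<open>K + 1\<close> in the conclusion.\<close>
  define \<phi> where "\<phi> n x = max 0 (min M (g n x)) * max 0 (min 1 (K + 1 - norm x))" for n x
  have cont: "continuous_on UNIV (\<phi> n)" for n
    unfolding \<phi>_def by (intro continuous_intros g)
  have [measurable]: "\<phi> n \<in> borel_measurable borel" for n
    using cont by (rule borel_measurable_continuous_onI)
  have \<phi>_nonneg: "0 \<le> \<phi> n x" for n x unfolding \<phi>_def by simp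
  have \<phi>_bound: "\<phi> n x \<le> M" for n x
  proof -
    have "\<phi> n x \<le> M * 1" unfolding \<phi>_def by (rule mult_mono) (use M in auto)
    then show ?thesis by simp
  qed
  have \<phi>_supp: "\<phi> n x = 0" if "norm x > K + 1" for n x
    using that unfolding \<phi>_def by auto
  have ptw: "(\<lambda>n. \<phi> n x) \<longlonglongrightarrow> h x" if "x \<notin> N" for x
  proof -
    have "(\<lambda>n. \<phi> n x) \<longlonglongrightarrow> max 0 (min M (h x)) * max 0 (min 1 (K + 1 - norm x))"
      unfolding \<phi>_def by (intro tendsto_intros lim that)
    also have "max 0 (min M (h x)) * max 0 (min 1 (K + 1 - norm x)) = h x"
      using bound[of x] supp[of x] by (cases "norm x > K") auto
    finally show ?thesis .
  qed
  have AE_N: "AE x in lborel. x \<notin> N"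
    using N AE_completion_iff[of "\<lambda>x. x \<notin> N" lborel] by (simp add: negligible_iff_null_sets AE_not_in)
  have "(\<lambda>n. LINT x|lborel. \<bar>\<phi> n x - h x\<bar>) \<longlonglongrightarrow> (LINT x|(lborel::'a measure). (0::real))"
  proof (rule integral_dominated_convergence)
    show "integrable lborel (\<lambda>x::'a. 2 * M * indicator (cball 0 (K+1)) x :: real)"
      using M by (intro integrable_lborel_bounded_support[where M="2*M" and K="K+1"]) (auto simp: indicator_def)
    show "AE x in lborel. (\<lambda>n. \<bar>\<phi> n x - h x\<bar>) \<longlonglongrightarrow> 0"
      using AE_N
    proof eventually_elim
      case (elim x)
      from tendsto_diff[OF ptw[OF elim] tendsto_const[of "h x"]] show ?case
        by (intro tendsto_rabs_zero) simp
    qed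
    show "AE x in lborel. norm \<bar>\<phi> n x - h x\<bar> \<le> 2 * M * indicator (cball 0 (K + 1)) x" for n
    proof (rule AE_I2)
      fix x
      show "norm \<bar>\<phi> n x - h x\<bar> \<le> 2 * M * indicator (cball 0 (K + 1)) x"
        using \<phi>_nonneg[of n x] \<phi>_bound[of n x] bound[of x] \<phi>_supp[of x n] supp[of x] M
        by (cases "norm x > K + 1") (auto simp: indicator_def)
    qed
  qed auto
  then have "\<forall>\<^sub>F n in sequentially. (LINT x|lborel. \<bar>\<phi> n x - h x\<bar>) < e"
    using \<open>e > 0\<close> by (intro order_tendstoD(2)[of _ 0]) auto
  then obtain n where "(LINT x|lborel. \<bar>\<phi> n x - h x\<bar>) < e"
    by (auto simp: eventually_sequentially)
  moreover have "\<bar>\<phi> n x\<bar> \<le> M" for x using \<phi>_nonneg[of n x] \<phi>_bound[of n x] by auto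
  ultimately show thesis using that[of "\<phi> n"] cont \<phi>_supp by auto
qed

text \<open>A three-epsilon argument: \<open>h\<close> is replaced by a continuous
  \<open>\<phi>\<close> close to it in L^1. The two replacement errors are unaffected by
  translation, and for \<open>\<phi>\<close> itself the translates converge pointwise under a common
  bound.\<close>

lemma L1_translation_continuous:
  fixes h :: "'a::euclidean_space \<Rightarrow> real"
  assumes h[measurable]: "h \<in> borel_measurable borel"
    and bound: "\<And>x. 0 \<le> h x" "\<And>x. h x \<le> M" and supp: "\<And>x. norm x > K \<Longrightarrow> h x = 0"
    and u: "u \<longlonglongrightarrow> v"
  shows "(\<lambda>n. LINT x|lborel. \<bar>h (x - u n) - h (x - v)\<bar>) \<longlonglongrightarrow> 0"
proof (rule LIMSEQ_I)
  fix e :: real assume "e > 0"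
  then have "e / 3 > 0" by simp
  then obtain \<phi> where cont: "continuous_on UNIV \<phi>" and \<phi>_bound: "\<And>x. \<bar>\<phi> x\<bar> \<le> M"
    and \<phi>_supp: "\<And>x. norm x > K + 1 \<Longrightarrow> \<phi> x = 0" and close: "(LINT x|lborel. \<bar>\<phi> x - h x\<bar>) < e / 3"
    using ex_continuous_L1_close[where h=h and M=M and K=K, OF h bound supp] by blast
  have M: "0 \<le> M" using bound[of 0] by linarith
  have [measurable]: "\<phi> \<in> borel_measurable borel"
    using cont by (rule borel_measurable_continuous_onI)
  from u have "Bseq u" by (rule convergent_imp_Bseq[OF convergentI])
  \<comment> \<open>\<open>U\<close> bounds all shifts and their limit, so every translate of
    \<open>\<phi>\<close> and \<open>h\<close> that occurs vanishes outside the ball of radius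
    \<open>K + 1 + U\<close>. This supplies one dominating function for all
    \<open>n\<close>.\<close>
  then obtain U where U: "\<And>n. norm (u n) \<le> U" by (auto simp: Bseq_def)
  have Uv: "norm v \<le> U"
    by (rule LIMSEQ_le_const2[OF tendsto_norm[OF u]]) (use U in auto)
  have far: "norm (x - z) > K + 1" if "norm x > K + 1 + U" "norm z \<le> U" for x z :: 'a
    using that norm_triangle_ineq2[of x z] by linarith
  have bd1: "\<bar>\<phi> (x - a) - \<phi> (x - b)\<bar> \<le> 2 * M" for x a b
    using \<phi>_bound[of "x - a"] \<phi>_bound[of "x - b"] by linarith
  have "(\<lambda>n. LINT x|lborel. \<bar>\<phi> (x - u n) - \<phi> (x - v)\<bar>) \<longlonglongrightarrow> (LINT x|(lborel::'a measure). (0::real))"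
  proof (rule integral_dominated_convergence)
    show "integrable lborel (\<lambda>x::'a. 2 * M * indicator (cball 0 (K+1+U)) x :: real)"
      using M by (intro integrable_lborel_bounded_support[where M="2*M" and K="K+1+U"]) (auto simp: indicator_def)
    show "AE x in lborel. (\<lambda>n. \<bar>\<phi> (x - u n) - \<phi> (x - v)\<bar>) \<longlonglongrightarrow> 0"
    proof (rule AE_I2)
      fix x
      have "(\<lambda>n. \<phi> (x - u n)) \<longlonglongrightarrow> \<phi> (x - v)"
        by (rule continuous_on_tendsto_compose[OF cont]) (auto intro: tendsto_intros u)
      from tendsto_diff[OF this tendsto_const[of "\<phi> (x - v)"]]
      show "(\<lambda>n. \<bar>\<phi> (x - u n) - \<phi> (x - v)\<bar>) \<longlonglongrightarrow> 0"
        by (intro tendsto_rabs_zero) simp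
    qed
    show "AE x in lborel. norm \<bar>\<phi> (x - u n) - \<phi> (x - v)\<bar> \<le> 2 * M * indicator (cball 0 (K+1+U)) x" for n
    proof (rule AE_I2)
      fix x
      show "norm \<bar>\<phi> (x - u n) - \<phi> (x - v)\<bar> \<le> 2 * M * indicator (cball 0 (K+1+U)) x"
        using bd1[of x "u n" v] \<phi>_supp[of "x - u n"] \<phi>_supp[of "x - v"] far[of x, OF _ U[of n]] far[of x, OF _ Uv]
        by (cases "norm x > K + 1 + U") (auto simp: indicator_def)
    qed
  qed auto
  then have "\<forall>\<^sub>F n in sequentially. (LINT x|lborel. \<bar>\<phi> (x - u n) - \<phi> (x - v)\<bar>) < e / 3"
    using \<open>e > 0\<close> by (intro order_tendstoD(2)[of _ 0]) auto
  moreover have "norm ((LINT x|lborel. \<bar>h (x - u n) - h (x - v)\<bar>) - 0) < e"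
    if n: "(LINT x|lborel. \<bar>\<phi> (x - u n) - \<phi> (x - v)\<bar>) < e / 3" for n
  proof -
    let ?d = "\<lambda>z x. \<bar>\<phi> (x - z) - h (x - z)\<bar>"
    have int0: "integrable lborel (\<lambda>x. \<bar>\<phi> x - h x\<bar>)"
    proof (rule integrable_lborel_bounded_support[where M="2*M" and K="K+1"])
      show "\<bar>\<bar>\<phi> x - h x\<bar>\<bar> \<le> 2 * M" for x using \<phi>_bound[of x] bound[of x] by linarith
      show "\<bar>\<phi> x - h x\<bar> = 0" if "K + 1 < norm x" for x using that supp[of x] \<phi>_supp[of x] by auto
    qed auto
    have int_d: "integrable lborel (?d z)" if "norm z \<le> U" for z
    proof (rule integrable_lborel_bounded_support[where M="2*M" and K="K+1+U"])
      show "\<bar>\<bar>\<phi> (x-z) - h (x-z)\<bar>\<bar> \<le> 2 * M" for x using \<phi>_bound[of "x-z"] bound[of "x-z"] by linarith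
      show "\<bar>\<phi> (x-z) - h (x-z)\<bar> = 0" if "K + 1 + U < norm x" for x
        using supp[of "x-z"] \<phi>_supp[of "x-z"] far[OF that \<open>norm z \<le> U\<close>] by auto
    qed auto
    \<comment> \<open>\<open>?d z\<close> is a translate of \<open>\<bar>\<phi> - h\<bar>\<close>,
      so its integral does not depend on \<open>z\<close>; this serves both \<open>z = u n\<close>
      and \<open>z = v\<close>.\<close>
    have eq_d: "(LINT x|lborel. ?d z x) < e / 3" for z
      using integral_lborel_translate[of "\<lambda>x. \<bar>\<phi> x - h x\<bar>" z] close by simp
    have int_m: "integrable lborel (\<lambda>x. \<bar>\<phi> (x - u n) - \<phi> (x - v)\<bar>)"
    proof (rule integrable_lborel_bounded_support[where M="2*M" and K="K+1+U"])
      show "\<bar>\<bar>\<phi> (x - u n) - \<phi> (x - v)\<bar>\<bar> \<le> 2 * M" for x using bd1[of x "u n" v] by simp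
      show "\<bar>\<phi> (x - u n) - \<phi> (x - v)\<bar> = 0" if "K + 1 + U < norm x" for x
        using \<phi>_supp[OF far[OF that U[of n]]] \<phi>_supp[OF far[OF that Uv]] by simp
    qed simp
    have "(LINT x|lborel. \<bar>h (x - u n) - h (x - v)\<bar>)
        \<le> (LINT x|lborel. ?d (u n) x + \<bar>\<phi> (x - u n) - \<phi> (x - v)\<bar> + ?d v x)"
    proof (rule integral_mono')
      show "integrable lborel (\<lambda>x. ?d (u n) x + \<bar>\<phi> (x - u n) - \<phi> (x - v)\<bar> + ?d v x)"
        by (intro Bochner_Integration.integrable_add int_d int_m U Uv)
      show "\<bar>h (x - u n) - h (x - v)\<bar> \<le> ?d (u n) x + \<bar>\<phi> (x - u n) - \<phi> (x - v)\<bar> + ?d v x" for x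
        by linarith
    qed auto
    also have "\<dots> = (LINT x|lborel. ?d (u n) x) + (LINT x|lborel. \<bar>\<phi> (x - u n) - \<phi> (x - v)\<bar>) + (LINT x|lborel. ?d v x)"
      by (simp add: int_d int_m U Uv)
    also have "\<dots> < e" using eq_d[of "u n"] eq_d[of v] n by linarith
    finally show ?thesis by (simp add: abs_of_nonneg)
  qed
  ultimately show "\<exists>no. \<forall>n\<ge>no. norm ((LINT x|lborel. \<bar>h (x - u n) - h (x - v)\<bar>) - 0) < e"
    unfolding eventually_sequentially by blast
qed

subsection \<open>Minkowski's inequality for Banach function norms\<close>

text \<open>Continuity of translations gives, for each \<open>y\<close>, L^1 convergence of the
  translate by \<open>s i y\<close> to the translate by \<open>y\<close>. Integrating over
  \<open>\<mu>\<close> and exchanging integrals gives L^1 convergence of the averages, and a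
  subsequence converges a.e.; the sequence obtained is that subsequence.\<close>

lemma convolution_simple_approximation:
  fixes h :: "'a::euclidean_space \<Rightarrow> real"
  assumes M: "finite_measure \<mu>" and sets_M[measurable_cong]: "sets \<mu> = sets borel"
    and h[measurable]: "h \<in> borel_measurable borel"
    and bound: "\<And>x. 0 \<le> h x" "\<And>x. h x \<le> B" and supp: "\<And>x. norm x > K \<Longrightarrow> h x = 0"
  obtains s :: "nat \<Rightarrow> 'a \<Rightarrow> 'a" where "\<And>i. simple_function \<mu> (s i)"
    "AE x in lborel. (\<lambda>i. LINT y|\<mu>. h (x - s i y)) \<longlonglongrightarrow> (LINT y|\<mu>. h (x - y))"
proof -
  interpret M: finite_measure \<mu> by (rule M)
  have sp[simp]: "space \<mu> = UNIV" using sets_eq_imp_space_eq[OF sets_M] by simp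
  interpret P: pair_sigma_finite \<mu> lborel ..
  have "(\<lambda>x. x) \<in> borel_measurable \<mu>" by measurable
  \<comment> \<open>Simple functions converging pointwise to the identity: their finite range is
    what later turns the average into a finite sum of translates.\<close>
  from borel_measurable_implies_sequence_metric[OF this, of 0]
  obtain s where s: "\<And>i. simple_function \<mu> (s i)" "\<And>x. (\<lambda>i. s i x) \<longlonglongrightarrow> x"
    by auto
  have [measurable]: "s i \<in> borel_measurable \<mu>" for i
    using s(1) by (rule borel_measurable_simple_function)
  have inth: "integrable lborel h"
    by (rule integrable_lborel_bounded_support[where M=B and K=K]) (use bound supp in auto)
  have "integrable (distr lborel borel ((+) (- z))) h" for z
    using inth by (simp only: lborel_distr_plus)
  then have inthz: "integrable lborel (\<lambda>x. h (x - z))" for z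
    by (subst (asm) integrable_distr_eq) auto
  define d where "d i y x = \<bar>h (x - s i y) - h (x - y)\<bar>" for i y x
  have [measurable]: "case_prod (d i) \<in> borel_measurable (\<mu> \<Otimes>\<^sub>M lborel)" for i
    unfolding d_def by measurable
  \<comment> \<open>The L^1 distance between the translates of \<open>h\<close> by
    \<open>s i y\<close> and by \<open>y\<close>. It tends to 0 for each \<open>y\<close> and is at
    most twice the L^1 norm of \<open>h\<close>, a constant and hence integrable over the finite
    measure \<open>\<mu>\<close>.\<close>
  define D where "D i y = (LINT x|lborel. d i y x)" for i y
  have [measurable]: "D i \<in> borel_measurable \<mu>" for i
    unfolding D_def by measurable
  have intd: "integrable lborel (d i y)" for i y
    unfolding d_def by (intro Bochner_Integration.integrable_abs Bochner_Integration.integrable_diff inthz)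
  have D_nonneg: "0 \<le> D i y" for i y unfolding D_def d_def by simp
  have D_bound: "D i y \<le> 2 * (LINT x|lborel. h x)" for i y
  proof -
    have "D i y \<le> (LINT x|lborel. h (x - s i y) + h (x - y))"
      unfolding D_def
    proof (rule integral_mono[OF intd])
      show "d i y x \<le> h (x - s i y) + h (x - y)" for x
        unfolding d_def using bound(1)[of "x - s i y"] bound(1)[of "x - y"] by linarith
    qed (intro Bochner_Integration.integrable_add inthz)
    also have "\<dots> = 2 * (LINT x|lborel. h x)"
      by (simp add: inthz integral_lborel_translate)
    finally show ?thesis .
  qed
  have D_lim: "(\<lambda>i. LINT y|\<mu>. D i y) \<longlonglongrightarrow> (LINT y|\<mu>. (0::real))"
  proof (rule integral_dominated_convergence)
    show "integrable \<mu> (\<lambda>_. 2 * (LINT x|lborel. h x))" by simp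
    show "AE y in \<mu>. (\<lambda>i. D i y) \<longlonglongrightarrow> 0"
      unfolding D_def d_def using L1_translation_continuous[OF h bound supp s(2)] by simp
    show "AE y in \<mu>. norm (D i y) \<le> 2 * (LINT x|lborel. h x)" for i
      using D_nonneg[of i] D_bound[of i] by simp
  qed auto
  have intD: "integrable \<mu> (D i)" for i
    by (rule M.integrable_const_bound[where B="2 * (LINT x|lborel. h x)"])
      (use D_nonneg[of i] D_bound[of i] in auto)
  have int2: "integrable (\<mu> \<Otimes>\<^sub>M lborel) (case_prod (d i))" for i
  proof (rule P.Fubini_integrable)
    show "integrable \<mu> (\<lambda>y. LINT x|lborel. norm (case (y, x) of (y, x) \<Rightarrow> d i y x))"
      using intD[of i] unfolding D_def d_def by simp
    show "AE y in \<mu>. integrable lborel (\<lambda>x. case (y, x) of (y, x) \<Rightarrow> d i y x)"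
      using intd by simp
  qed measurable
  \<comment> \<open>The same integrand integrated over \<open>\<mu>\<close> first:
    \<open>u i x\<close> bounds the error of the average at \<open>x\<close>, while by Fubini its
    L^1 norm is the integral of \<open>D i\<close>, which tends to 0.\<close>
  define u where "u i x = (LINT y|\<mu>. d i y x)" for i x
  have u_nonneg: "0 \<le> u i x" for i x unfolding u_def d_def by simp
  have "integrable lborel (u i)" for i
    using P.integrable_snd[OF int2[of i]] unfolding u_def by simp
  moreover have "(\<lambda>i. LINT x|lborel. norm (u i x)) \<longlonglongrightarrow> 0"
  proof -
    have "(LINT x|lborel. norm (u i x)) = (LINT y|\<mu>. D i y)" for i
      using P.Fubini_integral[OF int2[of i]] u_nonneg unfolding u_def D_def by simp
    then show ?thesis using D_lim by simp
  qed
  ultimately obtain r :: "nat \<Rightarrow> nat" where r: "AE x in lborel. (\<lambda>i. u (r i) x) \<longlonglongrightarrow> 0"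
    using tendsto_L1_AE_subseq[of lborel u] by auto
  have "AE x in lborel. (\<lambda>i. LINT y|\<mu>. h (x - s (r i) y)) \<longlonglongrightarrow> (LINT y|\<mu>. h (x - y))"
    using r
  proof eventually_elim
    case (elim x)
    have int1: "integrable \<mu> (\<lambda>y. h (x - y))"
      by (rule M.integrable_const_bound[where B=B]) (use bound in auto)
    have int3: "integrable \<mu> (\<lambda>y. h (x - s i y))" for i
      by (rule M.integrable_const_bound[where B=B]) (use bound in auto)
    have "norm ((LINT y|\<mu>. h (x - s (r i) y)) - (LINT y|\<mu>. h (x - y))) \<le> u (r i) x" for i
    proof -
      have "(LINT y|\<mu>. h (x - s (r i) y)) - (LINT y|\<mu>. h (x - y)) = (LINT y|\<mu>. h (x - s (r i) y) - h (x - y))"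
        by (rule Bochner_Integration.integral_diff[symmetric, OF int3 int1])
      also have "norm \<dots> \<le> (LINT y|\<mu>. norm (h (x - s (r i) y) - h (x - y)))"
        by (rule integral_norm_bound)
      finally show ?thesis unfolding u_def d_def by simp
    qed
    then have "(\<lambda>i. (LINT y|\<mu>. h (x - s (r i) y)) - (LINT y|\<mu>. h (x - y))) \<longlonglongrightarrow> 0"
      by (intro Lim_null_comparison[OF _ elim]) auto
    then show ?case by (rule LIM_zero_cancel)
  qed
  with s(1) show thesis by (intro that[of "\<lambda>i. s (r i)"]) auto
qed

section \<open>Calculus of a Banach function norm: Fatou property, Hoelder and Minkowski
  inequalities\<close>

context
  fixes \<rho> :: "('a::euclidean_space \<Rightarrow> ennreal) \<Rightarrow> ennreal"
  assumes \<rho>: "banach_function_norm \<rho>"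
begin

lemma banach_function_norm_eq_0_iff:
  "f \<in> borel_measurable lebesgue \<Longrightarrow> \<rho> f = 0 \<longleftrightarrow> (AE x in lebesgue. f x = 0)"
  using \<rho> unfolding banach_function_norm_def by blast

lemma banach_function_norm_cmult:
  "f \<in> borel_measurable lebesgue \<Longrightarrow> 0 \<le> a \<Longrightarrow> \<rho> (\<lambda>x. ennreal a * f x) = ennreal a * \<rho> f"
  using \<rho> unfolding banach_function_norm_def by blast

lemma banach_function_norm_add:
  "f \<in> borel_measurable lebesgue \<Longrightarrow> g \<in> borel_measurable lebesgue \<Longrightarrow> \<rho> (\<lambda>x. f x + g x) \<le> \<rho> f + \<rho> g"
  using \<rho> unfolding banach_function_norm_def by blast

lemma banach_function_norm_mono_AE:
  "f \<in> borel_measurable lebesgue \<Longrightarrow> g \<in> borel_measurable lebesgue \<Longrightarrow>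
    AE x in lebesgue. g x \<le> f x \<Longrightarrow> \<rho> g \<le> \<rho> f"
  using \<rho> unfolding banach_function_norm_def by blast

lemma banach_function_norm_cong_AE:
  "f \<in> borel_measurable lebesgue \<Longrightarrow> g \<in> borel_measurable lebesgue \<Longrightarrow>
    AE x in lebesgue. f x = g x \<Longrightarrow> \<rho> f = \<rho> g"
  by (intro antisym banach_function_norm_mono_AE) (auto elim: eventually_mono)

lemma banach_function_norm_monotone_convergence:
  "(\<And>j. F j \<in> borel_measurable lebesgue) \<Longrightarrow> f \<in> borel_measurable lebesgue \<Longrightarrow>
    AE x in lebesgue. incseq (\<lambda>j. F j x) \<and> (\<lambda>j. F j x) \<longlonglongrightarrow> f x \<Longrightarrow>
    (\<lambda>j. \<rho> (F j)) \<longlonglongrightarrow> \<rho> f"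
  using \<rho> unfolding banach_function_norm_def by blast

lemma banach_function_norm_indicator_finite:
  "E \<in> sets lebesgue \<Longrightarrow> emeasure lebesgue E < \<infinity> \<Longrightarrow> \<rho> (indicator E) < \<infinity>"
  using \<rho> unfolding banach_function_norm_def by blast

lemma banach_function_norm_sum:
  assumes "finite I" "\<And>i. i \<in> I \<Longrightarrow> f i \<in> borel_measurable lebesgue"
  shows "\<rho> (\<lambda>x. \<Sum>i\<in>I. f i x) \<le> (\<Sum>i\<in>I. \<rho> (f i))"
  using assms
proof (induction I)
  case empty
  then show ?case using banach_function_norm_eq_0_iff[of "\<lambda>_. 0"] by simp
next
  case (insert i I)
  then have "\<rho> (\<lambda>x. f i x + (\<Sum>i\<in>I. f i x)) \<le> \<rho> (f i) + \<rho> (\<lambda>x. \<Sum>i\<in>I. f i x)"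
    by (intro banach_function_norm_add) auto
  also have "\<dots> \<le> \<rho> (f i) + (\<Sum>i\<in>I. \<rho> (f i))"
    using insert by (intro add_left_mono) auto
  finally show ?case using insert by simp
qed

text \<open>The infima over the tails increase to the lower limit, which is \<open>f\<close> a.e.,
  so (A3) applies to them; by (A2) each has norm at most that of some \<open>F j\<close>, hence at
  most \<open>c\<close>.\<close>

lemma banach_function_norm_Fatou:
  assumes F[measurable]: "\<And>i. F i \<in> borel_measurable lebesgue" and f: "f \<in> borel_measurable lebesgue"
    and lim: "AE x in lebesgue. (\<lambda>i. F i x) \<longlonglongrightarrow> f x" and le: "\<And>i. \<rho> (F i) \<le> c"
  shows "\<rho> f \<le> c"
proof -
  define g where "g j x = (INF i\<in>{j..}. F i x)" for j :: nat and x
  have [measurable]: "g j \<in> borel_measurable lebesgue" for j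
    unfolding g_def by measurable
  have "(\<lambda>j. \<rho> (g j)) \<longlonglongrightarrow> \<rho> f"
  proof (rule banach_function_norm_monotone_convergence)
    show "AE x in lebesgue. incseq (\<lambda>j. g j x) \<and> (\<lambda>j. g j x) \<longlonglongrightarrow> f x"
      using lim
    proof eventually_elim
      case (elim x)
      have inc: "incseq (\<lambda>j. g j x)"
        unfolding g_def incseq_def by (auto intro!: INF_superset_mono)
      have "(SUP j. g j x) = f x"
        using lim_imp_Liminf[OF _ elim] unfolding g_def liminf_SUP_INF by simp
      with LIMSEQ_SUP[OF inc] inc show ?case by simp
    qed
  qed (auto intro: f)
  moreover have "\<rho> (g j) \<le> c" for j
  proof -
    have "\<rho> (g j) \<le> \<rho> (F j)"
      by (rule banach_function_norm_mono_AE) (auto simp: g_def intro: INF_lower)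
    also note le
    finally show ?thesis .
  qed
  ultimately show ?thesis by (intro LIMSEQ_le_const2) auto
qed

text \<open>Dividing \<open>f\<close> by its norm gives a competitor in the supremum defining
  \<open>assoc_norm\<close>. If the norm is 0, then \<open>f\<close> vanishes a.e. and so does the
  left-hand side.\<close>

lemma banach_function_norm_Hoelder:
  assumes f[measurable]: "f \<in> borel_measurable lebesgue" and g[measurable]: "g \<in> borel_measurable lebesgue"
    and fin: "\<rho> f < \<infinity>"
  shows "(\<integral>\<^sup>+x. f x * g x \<partial>lebesgue) \<le> \<rho> f * assoc_norm \<rho> g"
proof (cases "\<rho> f = 0")
  case True
  then have "AE x in lebesgue. f x * g x = 0"
    using banach_function_norm_eq_0_iff[OF f] by (auto elim: eventually_mono)
  then have "(\<integral>\<^sup>+x. f x * g x \<partial>lebesgue) = 0"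
    by (subst nn_integral_0_iff_AE) auto
  then show ?thesis by simp
next
  case False
  then obtain r where r: "\<rho> f = ennreal r" "r > 0"
    using fin by (cases "\<rho> f") (auto simp: ennreal_eq_0_iff not_le)
  have "\<rho> (\<lambda>x. ennreal (1/r) * f x) = ennreal (1/r) * ennreal r"
    using r by (subst banach_function_norm_cmult) auto
  also have "\<dots> = 1" using r by (simp flip: ennreal_mult)
  finally have "(\<integral>\<^sup>+x. ennreal (1/r) * f x * g x \<partial>lebesgue) \<le> assoc_norm \<rho> g"
    unfolding assoc_norm_def by (intro SUP_upper) auto
  also have "(\<integral>\<^sup>+x. ennreal (1/r) * f x * g x \<partial>lebesgue) = ennreal (1/r) * (\<integral>\<^sup>+x. f x * g x \<partial>lebesgue)"
    by (simp add: mult.assoc nn_integral_cmult)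
  finally have "ennreal r * (ennreal (1/r) * (\<integral>\<^sup>+x. f x * g x \<partial>lebesgue)) \<le> ennreal r * assoc_norm \<rho> g"
    by (rule mult_left_mono) simp
  moreover have "ennreal r * ennreal (1/r) = 1" using r by (simp flip: ennreal_mult)
  ultimately show ?thesis using r by (simp flip: mult.assoc)
qed

text \<open>As \<open>s\<close> has finitely many values, the average is a finite sum of translates
  of \<open>H\<close> whose weights add up to the total mass, so the triangle inequality suffices.
  Invariance is assumed for this \<open>H\<close> because \<open>translation_invariant\<close>
  speaks only of complex functions in \<open>Yspace \<rho>\<close>.\<close>

lemma banach_function_norm_simple_average:
  assumes M: "finite_measure \<mu>" and s: "simple_function \<mu> s"
    and H[measurable]: "H \<in> borel_measurable borel"
    and inv: "\<And>v. \<rho> (\<lambda>x. H (x - v)) = \<rho> H"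
  shows "(\<lambda>x. \<integral>\<^sup>+y. H (x - s y) \<partial>\<mu>) \<in> borel_measurable borel"
    and "\<rho> (\<lambda>x. \<integral>\<^sup>+y. H (x - s y) \<partial>\<mu>) \<le> emeasure \<mu> (space \<mu>) * \<rho> H"
proof -
  interpret M: finite_measure \<mu> by (rule M)
  let ?V = "s ` space \<mu>" and ?E = "\<lambda>v. s -` {v} \<inter> space \<mu>"
  have [measurable]: "?E v \<in> sets \<mu>" for v using s by (rule simple_functionD)
  have fin: "finite ?V" using s by (rule simple_functionD)
  \<comment> \<open>Stated for general \<open>G\<close> as it is used twice: with
    \<open>G v = H (x - v)\<close> for the average, and with the constant \<open>\<rho> H\<close> to
    add up the weights.\<close>
  have eq: "(\<integral>\<^sup>+y. G (s y) \<partial>\<mu>) = (\<Sum>v\<in>?V. emeasure \<mu> (?E v) * G v)" for G :: "'a \<Rightarrow> ennreal"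
  proof -
    have "(\<integral>\<^sup>+y. G (s y) \<partial>\<mu>) = (\<integral>\<^sup>+y. (\<Sum>v\<in>?V. G v * indicator (?E v) y) \<partial>\<mu>)"
    proof (rule nn_integral_cong)
      fix y assume "y \<in> space \<mu>"
      then have "(\<Sum>v\<in>?V. G v * indicator (?E v) y) = (\<Sum>v\<in>?V. if v = s y then G v else 0)"
        by (intro sum.cong) (auto simp: indicator_def)
      also have "\<dots> = G (s y)" using fin \<open>y \<in> space \<mu>\<close> by (simp add: sum.delta)
      finally show "G (s y) = (\<Sum>v\<in>?V. G v * indicator (?E v) y)" by simp
    qed
    also have "\<dots> = (\<Sum>v\<in>?V. emeasure \<mu> (?E v) * G v)"
      by (subst nn_integral_sum) (auto simp: nn_integral_cmult_indicator mult.commute)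
    finally show ?thesis .
  qed
  have avg: "(\<lambda>x. \<integral>\<^sup>+y. H (x - s y) \<partial>\<mu>) = (\<lambda>x. \<Sum>v\<in>?V. emeasure \<mu> (?E v) * H (x - v))"
    by (rule ext, rule eq)
  have H'[measurable]: "(\<lambda>x. H (x - v)) \<in> borel_measurable lebesgue" for v
    by (rule measurable_completion) measurable
  show "(\<lambda>x. \<integral>\<^sup>+y. H (x - s y) \<partial>\<mu>) \<in> borel_measurable borel"
    unfolding avg by measurable
  have "\<rho> (\<lambda>x. \<Sum>v\<in>?V. emeasure \<mu> (?E v) * H (x - v)) \<le> (\<Sum>v\<in>?V. \<rho> (\<lambda>x. emeasure \<mu> (?E v) * H (x - v)))"
    using fin by (rule banach_function_norm_sum) measurable
  also have "\<dots> = (\<Sum>v\<in>?V. emeasure \<mu> (?E v) * \<rho> H)"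
  proof (rule sum.cong[OF refl])
    fix v
    show "\<rho> (\<lambda>x. emeasure \<mu> (?E v) * H (x - v)) = emeasure \<mu> (?E v) * \<rho> H"
      using banach_function_norm_cmult[OF H', of "measure \<mu> (?E v)" v]
      by (simp add: M.emeasure_eq_measure inv)
  qed
  also have "\<dots> = emeasure \<mu> (space \<mu>) * \<rho> H"
    using eq[of "\<lambda>_. \<rho> H"] by (simp add: mult.commute)
  finally show "\<rho> (\<lambda>x. \<integral>\<^sup>+y. H (x - s y) \<partial>\<mu>) \<le> emeasure \<mu> (space \<mu>) * \<rho> H"
    unfolding avg .
qed

text \<open>The averages over simple functions obey the bound and converge a.e. to the convolution,
  so the Fatou property carries the bound over.\<close>

lemma banach_function_norm_convolution_bounded:
  fixes h :: "'a \<Rightarrow> real"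
  assumes ti: "translation_invariant \<rho>" and M: "finite_measure \<mu>" and sets_M[measurable_cong]: "sets \<mu> = sets borel"
    and h[measurable]: "h \<in> borel_measurable borel"
    and bound: "\<And>x. 0 \<le> h x" "\<And>x. h x \<le> B" and supp: "\<And>x. norm x > K \<Longrightarrow> h x = 0"
  shows "\<rho> (\<lambda>x. \<integral>\<^sup>+y. h (x - y) \<partial>\<mu>) \<le> emeasure \<mu> (space \<mu>) * \<rho> h"
proof -
  interpret M: finite_measure \<mu> by (rule M)
  have hL: "(\<lambda>x. ennreal (h x)) \<in> borel_measurable lebesgue"
    by (rule measurable_completion) measurable
  have indL: "(indicator (cball 0 K) :: 'a \<Rightarrow> ennreal) \<in> borel_measurable lebesgue"
    by (rule measurable_completion) (simp add: borel_measurable_indicator)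
  have B: "0 \<le> B" using bound[of 0] by linarith
  \<comment> \<open>Boundedness and bounded support make the norm of \<open>h\<close> finite through
    (A4). This puts \<open>h\<close> into \<open>Yspace \<rho>\<close>, where translation invariance
    is available.\<close>
  have "\<rho> (\<lambda>x. ennreal (h x)) \<le> \<rho> (\<lambda>x. ennreal B * indicator (cball 0 K) x)"
  proof (rule banach_function_norm_mono_AE)
    show "AE x in lebesgue. ennreal (h x) \<le> ennreal B * indicator (cball 0 K) x"
    proof (rule AE_I2)
      fix x show "ennreal (h x) \<le> ennreal B * indicator (cball 0 K) x"
        using bound(2)[of x] supp[of x] by (cases "norm x > K") (auto simp: ennreal_leI)
    qed
  qed (use hL indL in \<open>auto intro: borel_measurable_times_ennreal\<close>)
  also have "\<dots> = ennreal B * \<rho> (indicator (cball 0 K))"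
    using B indL by (intro banach_function_norm_cmult)
  also have "\<dots> < \<infinity>"
    using banach_function_norm_indicator_finite[of "cball 0 K"] emeasure_bounded_finite[of "cball (0::'a) K"]
    by (auto simp: ennreal_mult_less_top)
  finally have "(\<lambda>x. complex_of_real (h x)) \<in> Yspace \<rho>"
    using bound(1) measurable_completion[of "\<lambda>x. complex_of_real (h x)" lborel borel] by (simp add: Yspace_def Ynorm_def)
  then have "Ynorm \<rho> (\<lambda>x. complex_of_real (h (x - v))) = Ynorm \<rho> (\<lambda>x. complex_of_real (h x))" for v
    using ti unfolding translation_invariant_def by fast
  then have inv: "\<rho> (\<lambda>x. ennreal (h (x - v))) = \<rho> (\<lambda>x. ennreal (h x))" for v
    using bound(1) by (simp add: Ynorm_def)
  obtain s where s: "\<And>i. simple_function \<mu> (s i)"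
    and lim: "AE x in lborel. (\<lambda>i. LINT y|\<mu>. h (x - s i y)) \<longlonglongrightarrow> (LINT y|\<mu>. h (x - y))"
    using convolution_simple_approximation[OF M sets_M h bound supp] by blast
  have [measurable]: "s i \<in> borel_measurable \<mu>" for i
    using s by (rule borel_measurable_simple_function)
  \<comment> \<open>The limit was obtained for real integrals, the norm acts on extended ones; for
    bounded \<open>h\<close> and finite \<open>\<mu>\<close> the two agree.\<close>
  have eq: "(\<integral>\<^sup>+y. ennreal (h (x - t y)) \<partial>\<mu>) = ennreal (LINT y|\<mu>. h (x - t y))"
    if [measurable]: "t \<in> borel_measurable \<mu>" for x t
    by (intro nn_integral_eq_integral M.integrable_const_bound[where B=B]) (use bound in auto)
  note avg = banach_function_norm_simple_average[OF M s, of "\<lambda>x. ennreal (h x)"]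
  show ?thesis
  proof (rule banach_function_norm_Fatou)
    show "(\<lambda>x. \<integral>\<^sup>+y. ennreal (h (x - s i y)) \<partial>\<mu>) \<in> borel_measurable lebesgue" for i
      by (rule measurable_completion) (use avg(1) inv in simp)
    show "(\<lambda>x. \<integral>\<^sup>+y. ennreal (h (x - y)) \<partial>\<mu>) \<in> borel_measurable lebesgue"
      by (rule measurable_completion) measurable
    show "AE x in lebesgue. (\<lambda>i. \<integral>\<^sup>+y. ennreal (h (x - s i y)) \<partial>\<mu>) \<longlonglongrightarrow> (\<integral>\<^sup>+y. ennreal (h (x - y)) \<partial>\<mu>)"
      using AE_completion[OF lim] by eventually_elim (simp add: eq tendsto_ennrealI)
    show "\<rho> (\<lambda>x. \<integral>\<^sup>+y. ennreal (h (x - s i y)) \<partial>\<mu>) \<le> emeasure \<mu> (space \<mu>) * \<rho> (\<lambda>x. ennreal (h x))" for i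
      using avg(2) inv by auto
  qed
qed

lemma banach_function_norm_convolution:
  assumes ti: "translation_invariant \<rho>" and M: "finite_measure \<mu>" and sets_M[measurable_cong]: "sets \<mu> = sets borel"
    and H[measurable]: "H \<in> borel_measurable borel"
  shows "\<rho> (\<lambda>x. \<integral>\<^sup>+y. H (x - y) \<partial>\<mu>) \<le> emeasure \<mu> (space \<mu>) * \<rho> H"
proof -
  interpret M: finite_measure \<mu> by (rule M)
  \<comment> \<open>Truncation at height \<open>k\<close> and radius \<open>k\<close>. The minimum
    with \<open>k\<close> is finite, so \<open>enn2real\<close> loses nothing, and the truncations
    increase to \<open>H\<close> even where \<open>H\<close> is infinite.\<close>
  define h where "h k x = (if norm x \<le> real k then enn2real (min (H x) (of_nat k)) else 0)" for k :: nat and x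
  have [measurable]: "h k \<in> borel_measurable borel" for k
    unfolding h_def by measurable
  have ennreal_h: "ennreal (h k x) = (if norm x \<le> real k then min (H x) (of_nat k) else 0)" for k x
    unfolding h_def by (auto simp: ennreal_enn2real_if min_def top_unique)
  have h_inc: "incseq (\<lambda>k. ennreal (h k x))" for x
    unfolding ennreal_h incseq_def by (auto intro: min.coboundedI2)
  have h_lim: "(\<lambda>k. ennreal (h k x)) \<longlonglongrightarrow> H x" for x
  proof -
    have "(\<lambda>k. min (H x) (of_nat k)) \<longlonglongrightarrow> min (H x) \<infinity>"
      by (intro tendsto_min tendsto_const) (simp add: of_nat_tendsto_top_ennreal)
    moreover have "\<forall>\<^sub>F k in sequentially. ennreal (h k x) = min (H x) (of_nat k)"
      using eventually_ge_at_top[of "nat \<lceil>norm x\<rceil>"]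
    proof eventually_elim
      case (elim k)
      then have "norm x \<le> real k" by linarith
      then show ?case by (simp add: ennreal_h)
    qed
    ultimately show ?thesis by (simp add: tendsto_cong)
  qed
  have "(\<lambda>k. \<rho> (\<lambda>x. \<integral>\<^sup>+y. h k (x - y) \<partial>\<mu>)) \<longlonglongrightarrow> \<rho> (\<lambda>x. \<integral>\<^sup>+y. H (x - y) \<partial>\<mu>)"
  proof (rule banach_function_norm_monotone_convergence)
    show "(\<lambda>x. \<integral>\<^sup>+y. ennreal (h k (x - y)) \<partial>\<mu>) \<in> borel_measurable lebesgue" for k
      by (rule measurable_completion) measurable
    show "(\<lambda>x. \<integral>\<^sup>+y. H (x - y) \<partial>\<mu>) \<in> borel_measurable lebesgue"
      by (rule measurable_completion) measurable
    show "AE x in lebesgue. incseq (\<lambda>k. \<integral>\<^sup>+y. ennreal (h k (x - y)) \<partial>\<mu>) \<and>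
        (\<lambda>k. \<integral>\<^sup>+y. ennreal (h k (x - y)) \<partial>\<mu>) \<longlonglongrightarrow> (\<integral>\<^sup>+y. H (x - y) \<partial>\<mu>)"
    proof (intro AE_I2 conjI)
      fix x
      show "incseq (\<lambda>k. \<integral>\<^sup>+y. ennreal (h k (x - y)) \<partial>\<mu>)"
        using h_inc by (auto simp: incseq_def intro!: nn_integral_mono)
      show "(\<lambda>k. \<integral>\<^sup>+y. ennreal (h k (x - y)) \<partial>\<mu>) \<longlonglongrightarrow> (\<integral>\<^sup>+y. H (x - y) \<partial>\<mu>)"
        by (rule nn_integral_LIMSEQ) (use h_inc h_lim in \<open>auto simp: incseq_def le_fun_def\<close>)
    qed
  qed
  moreover have "\<rho> (\<lambda>x. \<integral>\<^sup>+y. h k (x - y) \<partial>\<mu>) \<le> emeasure \<mu> (space \<mu>) * \<rho> H" for k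
  proof -
    have "\<rho> (\<lambda>x. \<integral>\<^sup>+y. h k (x - y) \<partial>\<mu>) \<le> emeasure \<mu> (space \<mu>) * \<rho> (h k)"
    proof (rule banach_function_norm_convolution_bounded[OF ti M sets_M, where B="real k" and K="real k"])
      show "h k x \<le> real k" for x
        unfolding h_def by (auto intro!: enn2real_leI simp: ennreal_of_nat_eq_real_of_nat)
    qed (auto simp: h_def)
    also have "\<rho> (h k) \<le> \<rho> H"
    proof (rule banach_function_norm_mono_AE)
      show "H \<in> borel_measurable lebesgue" by (rule measurable_completion) simp
      show "(\<lambda>x. ennreal (h k x)) \<in> borel_measurable lebesgue" by (rule measurable_completion) measurable
      show "AE x in lebesgue. ennreal (h k x) \<le> H x" by (simp add: ennreal_h)
    qed
    finally show ?thesis by (simp add: mult_left_mono)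
  qed
  ultimately show ?thesis by (intro LIMSEQ_le_const2) auto
qed

end

subsection \<open>Convolution with a bounded kernel\<close>

lemma lborel_distr_reflect:
  fixes x :: "'a::euclidean_space"
  shows "distr lborel borel (\<lambda>y. x - y) = lborel"
  by (subst (2) lborel_affine[of "-1" x]) (auto simp: density_1)

lemma AE_lborel_reflect:
  fixes x :: "'a::euclidean_space"
  assumes "AE z in lborel. P z"
  shows "AE y in lborel. P (x - y)"
proof -
  have "AE z in distr lborel borel (\<lambda>y. x - y). P z"
    using assms by (simp only: lborel_distr_reflect)
  then show ?thesis by (rule AE_distrD[rotated]) auto
qed

lemma nn_integral_lborel_reflect:
  fixes x :: "'a::euclidean_space"
  assumes [measurable]: "f \<in> borel_measurable borel"
  shows "(\<integral>\<^sup>+y. f (x - y) \<partial>lborel) = (\<integral>\<^sup>+y. f y \<partial>lborel)"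
proof -
  have "(\<integral>\<^sup>+y. f y \<partial>lborel) = (\<integral>\<^sup>+y. f y \<partial>distr lborel borel (\<lambda>y. x - y))"
    by (simp only: lborel_distr_reflect)
  also have "\<dots> = (\<integral>\<^sup>+y. f (x - y) \<partial>lborel)"
    by (rule nn_integral_distr) auto
  finally show ?thesis ..
qed

text \<open>Preimages under \<open>f\<close> and \<open>g\<close> differ only within a null set, and
  completeness makes such a change harmless. It gives measurability of the integrand of
  \<open>conv\<close> from that of its Borel representative.\<close>

lemma (in complete_measure) measurable_cong_AE:
  assumes f: "f \<in> M \<rightarrow>\<^sub>M N" and ae: "AE x in M. g x = f x" and g: "g \<in> space M \<rightarrow> space N"
  shows "g \<in> M \<rightarrow>\<^sub>M N"
proof (rule measurableI)
  fix A assume A: "A \<in> sets N"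
  show "g -` A \<inter> space M \<in> sets M"
  proof (rule in_sets_AE)
    show "AE x in M. x \<in> f -` A \<inter> space M \<longleftrightarrow> x \<in> g -` A \<inter> space M"
      using ae by eventually_elim auto
  qed (use f A in auto)
qed (use g in auto)

lemma ex_borel_AE_eq_complex:
  fixes f :: "'a::euclidean_space \<Rightarrow> complex"
  assumes [measurable]: "f \<in> borel_measurable lebesgue"
  obtains f' where "f' \<in> borel_measurable borel" "AE x in lebesgue. f x = f' x"
proof -
  obtain a where a[measurable]: "a \<in> borel_measurable lborel" "AE x in lborel. Re (f x) = a x"
    using completion_ex_borel_measurable_real[of "\<lambda>x. Re (f x)" lborel] by auto
  obtain b where b[measurable]: "b \<in> borel_measurable lborel" "AE x in lborel. Im (f x) = b x"
    using completion_ex_borel_measurable_real[of "\<lambda>x. Im (f x)" lborel] by auto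
  have "AE x in lborel. f x = complex_of_real (a x) + \<i> * complex_of_real (b x)"
    using a(2) b(2) by eventually_elim (simp add: complex_eq_iff)
  moreover have "(\<lambda>x. complex_of_real (a x) + \<i> * complex_of_real (b x)) \<in> borel_measurable borel"
    using a(1) b(1) by simp
  ultimately show thesis by (intro that) (auto intro: AE_completion)
qed

text \<open>The infimum is attained: it is approached by
  \<open>Linf_norm \<kappa> + 1 / real (Suc n)\<close>, and the countably many exceptional sets
  together form a null set.\<close>

lemma AE_le_Linf_norm:
  assumes "\<kappa> \<in> Linf"
  shows "0 \<le> Linf_norm \<kappa>" and "AE x in lebesgue. cmod (\<kappa> x) \<le> Linf_norm \<kappa>"
proof -
  let ?S = "{C::real. 0 \<le> C \<and> (AE x in lebesgue. cmod (\<kappa> x) \<le> C)}"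
  obtain C where "AE x in lebesgue. cmod (\<kappa> x) \<le> C"
    using assms unfolding Linf_def by auto
  then have "AE x in lebesgue. cmod (\<kappa> x) \<le> max 0 C"
    by eventually_elim auto
  then have "max 0 C \<in> ?S" by simp
  then have ne: "?S \<noteq> {}" by blast
  then show "0 \<le> Linf_norm \<kappa>"
    unfolding Linf_norm_def by (intro cInf_greatest) auto
  have "AE x in lebesgue. cmod (\<kappa> x) \<le> Linf_norm \<kappa> + 1 / real (Suc n)" for n
  proof -
    have "Inf ?S < Linf_norm \<kappa> + 1 / real (Suc n)" by (simp add: Linf_norm_def)
    then obtain c where "c \<in> ?S" "c < Linf_norm \<kappa> + 1 / real (Suc n)"
      using cInf_lessD[OF ne] by blast
    then show ?thesis by (auto elim!: eventually_mono)
  qed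
  then have "AE x in lebesgue. \<forall>n. cmod (\<kappa> x) \<le> Linf_norm \<kappa> + 1 / real (Suc n)"
    by (simp only: AE_all_countable) simp
  then show "AE x in lebesgue. cmod (\<kappa> x) \<le> Linf_norm \<kappa>"
  proof eventually_elim
    case (elim x)
    have "(\<lambda>n. Linf_norm \<kappa> + 1 / real (Suc n)) \<longlonglongrightarrow> Linf_norm \<kappa> + 0"
      by (intro tendsto_intros LIMSEQ_Suc[OF lim_1_over_n])
    with elim show ?case by (intro LIMSEQ_le_const) auto
  qed
qed

text \<open>For fixed \<open>x\<close> the map \<open>y \<mapsto> x - y\<close> preserves null sets,
  so the integrands agree a.e. for every \<open>x\<close>, not just almost every one. Hence
  \<open>conv \<kappa> f\<close> equals a Borel expression everywhere.\<close>

lemma conv_eq_lborel: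
  assumes k': "k' \<in> borel_measurable borel" "AE x in lebesgue. \<kappa> x = k' x"
    and f': "f' \<in> borel_measurable borel" "AE x in lebesgue. f x = f' x"
  shows "conv \<kappa> f x = (LINT y|lborel. k' (x - y) * f' y)"
proof -
  note [measurable] = k'(1) f'(1)
  have L: "(\<lambda>y. k' (x - y) * f' y) \<in> borel_measurable lebesgue"
    by (rule measurable_completion) measurable
  have "AE y in lborel. \<kappa> (x - y) = k' (x - y)"
    using k'(2) by (intro AE_lborel_reflect) (simp add: AE_completion_iff)
  from AE_completion[OF this] f'(2)
  have ae: "AE y in lebesgue. \<kappa> (x - y) * f y = k' (x - y) * f' y"
    by eventually_elim simp
  have "conv \<kappa> f x = (LINT y|lebesgue. k' (x - y) * f' y)"
    unfolding conv_def
    by (rule integral_cong_AE[OF completion.measurable_cong_AE[OF L ae] L ae]) simp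
  also have "\<dots> = (LINT y|lborel. k' (x - y) * f' y)"
    by (rule integral_completion) measurable
  finally show ?thesis .
qed

lemma conv_bounded_kernel:
  fixes \<kappa> f f' :: "'a::euclidean_space \<Rightarrow> complex"
  assumes \<kappa>: "\<kappa> \<in> Linf" and supp: "AE x in lebesgue. x \<notin> ball 0 \<epsilon> \<longrightarrow> \<kappa> x = 0"
    and f'[measurable]: "f' \<in> borel_measurable borel" and f_eq: "AE x in lebesgue. f x = f' x"
  shows "conv \<kappa> f \<in> borel_measurable borel"
    and "ennreal (cmod (conv \<kappa> f x)) \<le>
      ennreal (Linf_norm \<kappa>) * (\<integral>\<^sup>+y. indicator (ball 0 \<epsilon>) y * ennreal (cmod (f' (x - y))) \<partial>lborel)"
proof -
  obtain k' where k'[measurable]: "k' \<in> borel_measurable borel" and k_eq: "AE x in lebesgue. \<kappa> x = k' x"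
    using \<kappa> ex_borel_AE_eq_complex[of \<kappa>] unfolding Linf_def by auto
  note conv_eq = conv_eq_lborel[OF k' k_eq f' f_eq]
  show "conv \<kappa> f \<in> borel_measurable borel"
    unfolding conv_eq[abs_def] by measurable
  \<comment> \<open>If the integrand is not integrable, the Bochner integral is 0 by default and the
    bound is trivial.\<close>
  have "ennreal (cmod (conv \<kappa> f x)) \<le> (\<integral>\<^sup>+y. ennreal (cmod (k' (x - y) * f' y)) \<partial>lborel)"
    unfolding conv_eq
    by (cases "integrable lborel (\<lambda>y. k' (x - y) * f' y)")
      (auto intro: integral_norm_bound_ennreal simp: not_integrable_integral_eq)
  also have "\<dots> = (\<integral>\<^sup>+y. ennreal (cmod (k' y * f' (x - y))) \<partial>lborel)"
    using nn_integral_lborel_reflect[of "\<lambda>y. ennreal (cmod (k' (x - y) * f' y))" x] by simp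
  also have "\<dots> \<le> (\<integral>\<^sup>+y. ennreal (Linf_norm \<kappa>) * (indicator (ball 0 \<epsilon>) y * ennreal (cmod (f' (x - y)))) \<partial>lborel)"
  proof (rule nn_integral_mono_AE)
    have "AE y in lebesgue. cmod (k' y * f' (x - y)) \<le> Linf_norm \<kappa> * (indicator (ball 0 \<epsilon>) y * cmod (f' (x - y)))"
      using AE_le_Linf_norm(2)[OF \<kappa>] k_eq supp
    proof eventually_elim
      case (elim y)
      then show ?case
        by (auto simp: norm_mult indicator_def intro: mult_right_mono)
    qed
    then show "AE y in lborel. ennreal (cmod (k' y * f' (x - y))) \<le>
        ennreal (Linf_norm \<kappa>) * (indicator (ball 0 \<epsilon>) y * ennreal (cmod (f' (x - y))))"
      unfolding AE_completion_iff
    proof eventually_elim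
      case (elim y)
      have "ennreal (cmod (k' y * f' (x - y))) \<le> ennreal (Linf_norm \<kappa> * (indicator (ball 0 \<epsilon>) y * cmod (f' (x - y))))"
        using elim by (rule ennreal_leI)
      also have "\<dots> = ennreal (Linf_norm \<kappa>) * (indicator (ball 0 \<epsilon>) y * ennreal (cmod (f' (x - y))))"
        using AE_le_Linf_norm(1)[OF \<kappa>] by (simp add: ennreal_mult indicator_def)
      finally show ?case .
    qed
  qed
  also have "\<dots> = ennreal (Linf_norm \<kappa>) * (\<integral>\<^sup>+y. indicator (ball 0 \<epsilon>) y * ennreal (cmod (f' (x - y))) \<partial>lborel)"
    by (intro nn_integral_cmult borel_measurable_times_ennreal) (simp_all add: borel_measurable_indicator)
  finally show "ennreal (cmod (conv \<kappa> f x)) \<le>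
      ennreal (Linf_norm \<kappa>) * (\<integral>\<^sup>+y. indicator (ball 0 \<epsilon>) y * ennreal (cmod (f' (x - y))) \<partial>lborel)" .
qed

subsection \<open>The weighted estimate\<close>

text \<open>The form in which the growth condition acts far from the origin:
  \<open>w x \<le> c * w (x - y)\<close> pulls the weight under the integral, where it turns
  \<open>G\<close> into \<open>H\<close>. Positivity of \<open>w (x - y)\<close> holds for a.e.
  \<open>y\<close> by reflection.\<close>

lemma nn_integral_ball_le:
  fixes G H :: "'a::euclidean_space \<Rightarrow> ennreal"
  assumes [measurable]: "G \<in> borel_measurable borel" "H \<in> borel_measurable borel"
    and w: "AE y in lborel. 0 < w y \<and> H y = G y * ennreal (w y)"
    and bound: "\<And>y. norm y < \<epsilon> \<Longrightarrow> w x / w (x - y) \<le> c"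
    and "0 \<le> c"
  shows "ennreal (w x) * (\<integral>\<^sup>+y. indicator (ball 0 \<epsilon>) y * G (x - y) \<partial>lborel)
    \<le> ennreal c * (\<integral>\<^sup>+y. indicator (ball 0 \<epsilon>) y * H (x - y) \<partial>lborel)"
proof -
  have [measurable]: "(indicator (ball 0 \<epsilon>) :: 'a \<Rightarrow> ennreal) \<in> borel_measurable borel"
    by (simp add: borel_measurable_indicator)
  have "ennreal (w x) * (\<integral>\<^sup>+y. indicator (ball 0 \<epsilon>) y * G (x - y) \<partial>lborel)
      = (\<integral>\<^sup>+y. ennreal (w x) * (indicator (ball 0 \<epsilon>) y * G (x - y)) \<partial>lborel)"
    by (rule nn_integral_cmult[symmetric]) measurable
  also have "\<dots> \<le> (\<integral>\<^sup>+y. ennreal c * (indicator (ball 0 \<epsilon>) y * H (x - y)) \<partial>lborel)"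
  proof (rule nn_integral_mono_AE)
    from AE_lborel_reflect[OF w, of x]
    show "AE y in lborel. ennreal (w x) * (indicator (ball 0 \<epsilon>) y * G (x - y))
        \<le> ennreal c * (indicator (ball 0 \<epsilon>) y * H (x - y))"
    proof eventually_elim
      case (elim y)
      show ?case
      proof (cases "norm y < \<epsilon>")
        case True
        then have "w x \<le> c * w (x - y)"
          using bound[OF True] elim by (simp add: pos_divide_le_eq)
        then have "ennreal (w x) \<le> ennreal c * ennreal (w (x - y))"
          using elim \<open>0 \<le> c\<close> by (simp add: ennreal_leI flip: ennreal_mult)
        then have "ennreal (w x) * G (x - y) \<le> ennreal c * ennreal (w (x - y)) * G (x - y)"
          by (rule mult_right_mono) simp
        then show ?thesis
          using True elim by (simp add: mult_ac)
      qed simp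
    qed
  qed
  also have "\<dots> = ennreal c * (\<integral>\<^sup>+y. indicator (ball 0 \<epsilon>) y * H (x - y) \<partial>lborel)"
    by (rule nn_integral_cmult) measurable
  finally show ?thesis .
qed

text \<open>For \<open>norm x < r\<close> and \<open>norm y < \<epsilon>\<close> the point
  \<open>x - y\<close> stays within radius \<open>r + \<epsilon>\<close>, so the local integrals
  have one bound independent of \<open>x\<close>.\<close>

lemma nn_integral_ball_reflect_le:
  fixes G :: "'a::euclidean_space \<Rightarrow> ennreal"
  assumes [measurable]: "G \<in> borel_measurable borel" and "norm x < r"
  shows "(\<integral>\<^sup>+y. indicator (ball 0 \<epsilon>) y * G (x - y) \<partial>lborel) \<le> (\<integral>\<^sup>+y\<in>ball 0 (r + \<epsilon>). G y \<partial>lborel)"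
proof -
  have "(\<integral>\<^sup>+y. indicator (ball 0 \<epsilon>) y * G (x - y) \<partial>lborel)
      \<le> (\<integral>\<^sup>+y. G (x - y) * indicator (ball 0 (r + \<epsilon>)) (x - y) \<partial>lborel)"
  proof (rule nn_integral_mono)
    fix y
    show "indicator (ball 0 \<epsilon>) y * G (x - y) \<le> G (x - y) * indicator (ball 0 (r + \<epsilon>)) (x - y)"
      using norm_triangle_ineq4[of x y] \<open>norm x < r\<close> by (cases "norm y < \<epsilon>") auto
  qed
  also have "\<dots> = (\<integral>\<^sup>+y\<in>ball 0 (r + \<epsilon>). G y \<partial>lborel)"
    by (rule nn_integral_lborel_reflect[where f="\<lambda>y. G y * indicator (ball 0 (r + \<epsilon>)) y"])
      (intro borel_measurable_times_ennreal borel_measurable_indicator, simp_all)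
  finally show ?thesis .
qed

text \<open>On \<open>E\<close> one has \<open>G = H * (1 / w)\<close> a.e., and Hoelder's
  inequality separates the factors. This is how the local condition on \<open>1 / w\<close>
  enters.\<close>

lemma nn_integral_local_weight_le:
  fixes \<rho> :: "('a::euclidean_space \<Rightarrow> ennreal) \<Rightarrow> ennreal"
  assumes \<rho>: "banach_function_norm \<rho>"
    and G: "G \<in> borel_measurable borel" and H: "H \<in> borel_measurable borel"
    and fin: "\<rho> H < \<infinity>"
    and w: "w \<in> borel_measurable lebesgue" "AE y in lborel. 0 < w y \<and> H y = G y * ennreal (w y)"
    and E: "E \<in> sets lebesgue"
  shows "(\<integral>\<^sup>+y\<in>E. G y \<partial>lborel)
    \<le> \<rho> H * assoc_norm \<rho> (\<lambda>x. ennreal (cmod (complex_of_real (1 / w x) * indicator E x)))"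
proof -
  let ?g = "\<lambda>x. ennreal (cmod (complex_of_real (1 / w x) * indicator E x))"
  note [measurable] = w(1) E
  have HL[measurable]: "H \<in> borel_measurable lebesgue"
    by (rule measurable_completion) (simp add: H)
  have "(\<integral>\<^sup>+y\<in>E. G y \<partial>lborel) = (\<integral>\<^sup>+y. H y * ?g y \<partial>lborel)"
  proof (rule nn_integral_cong_AE)
    show "AE y in lborel. G y * indicator E y = H y * ?g y"
      using w(2)
    proof eventually_elim
      case (elim y)
      have "ennreal (w y) * ennreal (1 / w y) = 1"
        using elim by (simp flip: ennreal_mult)
      then show ?case
        using elim by (simp add: norm_mult norm_divide indicator_def mult.assoc abs_of_pos)
    qed
  qed
  also have "\<dots> = (\<integral>\<^sup>+y. H y * ?g y \<partial>lebesgue)"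
    by (rule nn_integral_completion[symmetric])
  also have "\<dots> \<le> \<rho> H * assoc_norm \<rho> ?g"
    by (rule banach_function_norm_Hoelder[OF \<rho> HL _ fin]) measurable
  finally show ?thesis .
qed

section \<open>Combination of the estimates near the origin and far from it\<close>

theorem theorem8p4:
  fixes \<rho> :: "('a::euclidean_space \<Rightarrow> ennreal) \<Rightarrow> ennreal"
    and w :: "'a \<Rightarrow> real"
    and R \<epsilon> C\<epsilon> :: real
  assumes "banach_function_norm \<rho>"
    and "translation_invariant \<rho>"
    and "is_weight w"
    and "Yloc \<rho> (\<lambda>x. complex_of_real (w x))"
    and "Yassoc_loc \<rho> (\<lambda>x. complex_of_real (1 / w x))"
    and "R > 0" and "\<epsilon> > 0" and "C\<epsilon> > 0"
    and "\<forall>x y. norm x \<ge> R \<and> norm y \<le> \<epsilon> \<longrightarrow> w (x + y) / w x \<le> C\<epsilon>"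
  shows "\<exists>C>0. \<forall>\<kappa> \<in> Linf. \<forall>f \<in> Yw_space \<rho> w.
           (AE x in lebesgue. x \<notin> ball 0 \<epsilon> \<longrightarrow> \<kappa> x = 0) \<longrightarrow>
           Yw_norm \<rho> w (conv \<kappa> f) \<le> ennreal C * ennreal (Linf_norm \<kappa>) * Yw_norm \<rho> w f"
proof -
  note \<rho> = assms(1)
  have w[measurable]: "w \<in> borel_measurable lebesgue" and w_pos: "AE x in lborel. 0 < w x"
    using assms(3) by (simp_all add: is_weight_def AE_completion_iff)
  obtain w' where w'[measurable]: "w' \<in> borel_measurable borel" and w_eq: "AE x in lborel. w x = w' x"
    using completion_ex_borel_measurable_real[OF w] by auto
  \<comment> \<open>The near region is \<open>norm x < R + \<epsilon>\<close>; the points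
    \<open>x - y\<close> met there need one more \<open>\<epsilon>\<close>. The single set
    \<open>E\<close> contains both ranges, so it serves \<open>w\<close> and \<open>1 / w\<close>
    alike.\<close>
  define E where "E = ball (0::'a) (R + \<epsilon> + \<epsilon>)"
  have E[measurable]: "E \<in> sets lebesgue" "emeasure lebesgue E < \<infinity>"
    using emeasure_bounded_finite[of E] by (auto simp: E_def less_top)
  define wE where "wE x = ennreal (cmod (complex_of_real (w x) * indicator E x))" for x
  have wE[measurable]: "wE \<in> borel_measurable lebesgue" unfolding wE_def by measurable
  define A where "A = assoc_norm \<rho> (\<lambda>x. ennreal (cmod (complex_of_real (1 / w x) * indicator E x)))"
  have "A < \<infinity>" using assms(5) E unfolding A_def Yassoc_loc_def by blast
  then obtain a where a: "A = ennreal a" "0 \<le> a" by (cases A) auto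
  have "\<rho> wE < \<infinity>"
    using assms(4) E unfolding Yloc_def Yspace_def Ynorm_def wE_def by blast
  then obtain b where b: "\<rho> wE = ennreal b" "0 \<le> b" by (cases "\<rho> wE") auto
  \<comment> \<open>Lebesgue measure restricted to the ball: Minkowski's inequality for it controls
    averages over balls of radius \<open>\<epsilon>\<close>, with constant its total mass
    \<open>m\<close>.\<close>
  define \<mu> :: "'a measure" where "\<mu> = density lborel (indicator (ball 0 \<epsilon>))"
  have indB[measurable]: "(indicator (ball 0 \<epsilon>) :: 'a \<Rightarrow> ennreal) \<in> borel_measurable borel"
    by (simp add: borel_measurable_indicator)
  have sets_\<mu>: "sets \<mu> = sets borel" by (simp add: \<mu>_def)
  have fin_\<mu>: "finite_measure \<mu>"
    using emeasure_bounded_finite[of "ball (0::'a) \<epsilon>"]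
    by (intro finite_measureI) (simp add: \<mu>_def emeasure_density less_top)
  then obtain m where m: "emeasure \<mu> (space \<mu>) = ennreal m" "0 \<le> m"
    by (metis finite_measure.emeasure_eq_measure measure_nonneg)
  \<comment> \<open>\<open>C\<epsilon> * m\<close> comes from the far region and
    \<open>a * b\<close> from the near one; the 1 secures positivity.\<close>
  define C where "C = C\<epsilon> * m + a * b + 1"
  have "Yw_norm \<rho> w (conv \<kappa> f) \<le> ennreal C * ennreal (Linf_norm \<kappa>) * Yw_norm \<rho> w f"
    if \<kappa>: "\<kappa> \<in> Linf" and f: "f \<in> Yw_space \<rho> w"
      and supp: "AE x in lebesgue. x \<notin> ball 0 \<epsilon> \<longrightarrow> \<kappa> x = 0" for \<kappa> f
  proof -
    have fw[measurable]: "(\<lambda>x. f x * complex_of_real (w x)) \<in> borel_measurable lebesgue"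
      and fw_fin: "Yw_norm \<rho> w f < \<infinity>"
      using f by (auto simp: Yw_space_def Yspace_def Yw_norm_def)
    \<comment> \<open>Membership in \<open>Yw_space \<rho> w\<close> gives measurability of the
      product of \<open>f\<close> and \<open>w\<close> only. Dividing by \<open>w\<close> recovers
      \<open>f\<close> wherever \<open>w\<close> is positive, so \<open>f\<close> agrees a.e. with a
      Borel function.\<close>
    have "(\<lambda>x. f x * complex_of_real (w x) / complex_of_real (w x)) \<in> borel_measurable lebesgue"
      by measurable
    then obtain f' where f'[measurable]: "f' \<in> borel_measurable borel"
      and "AE x in lebesgue. f x * complex_of_real (w x) / complex_of_real (w x) = f' x"
      by (rule ex_borel_AE_eq_complex)
    then have f_eq: "AE x in lebesgue. f x = f' x"
      using AE_completion[OF w_pos] by (auto elim: eventually_elim2)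
    define G where "G x = ennreal (cmod (f' x))" for x
    \<comment> \<open>Built with the Borel representative \<open>w'\<close>, so that
      \<open>H\<close> is Borel as Minkowski's inequality requires; a.e. it is
      \<open>\<bar>f\<bar>\<close> times \<open>w\<close>.\<close>
    define H where "H x = G x * ennreal (w' x)" for x
    have G[measurable]: "G \<in> borel_measurable borel" unfolding G_def by measurable
    have H[measurable]: "H \<in> borel_measurable borel" unfolding H_def by measurable
    have HL: "H \<in> borel_measurable lebesgue"
      by (rule measurable_completion) (simp add: H)
    have GH: "AE x in lborel. 0 < w x \<and> H x = G x * ennreal (w x)"
      using w_pos w_eq by eventually_elim (simp add: H_def)
    have "AE x in lebesgue. ennreal (cmod (f x * complex_of_real (w x))) = H x"
      using AE_completion[OF GH] f_eq
      by eventually_elim (simp add: G_def norm_mult ennreal_mult abs_of_pos)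
    then have \<rho>H: "Yw_norm \<rho> w f = \<rho> H"
      unfolding Yw_norm_def Ynorm_def by (intro banach_function_norm_cong_AE[OF \<rho>] HL) measurable
    then have H_fin: "\<rho> H < \<infinity>" using fw_fin by simp
    define T where "T x = (\<integral>\<^sup>+y. H (x - y) \<partial>\<mu>)" for x
    have T_eq: "T x = (\<integral>\<^sup>+y. indicator (ball 0 \<epsilon>) y * H (x - y) \<partial>lborel)" for x
      unfolding T_def \<mu>_def by (rule nn_integral_density) measurable
    have TL[measurable]: "T \<in> borel_measurable lebesgue"
      unfolding T_eq[abs_def] by (rule measurable_completion) measurable
    have \<rho>T: "\<rho> T \<le> ennreal m * \<rho> H"
      using banach_function_norm_convolution[OF \<rho> assms(2) fin_\<mu> sets_\<mu> H] m by (simp add: T_def[abs_def])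
    obtain c where c: "A * \<rho> H = ennreal c" "0 \<le> c"
      using H_fin a by (cases "\<rho> H") (auto simp flip: ennreal_mult)
    have conv_borel: "conv \<kappa> f \<in> borel_measurable lebesgue"
      using conv_bounded_kernel(1)[OF \<kappa> supp f' f_eq] by (intro measurable_completion) simp
    \<comment> \<open>One majorant valid in both regions, so that the norm can be applied over the
      whole space: near the origin the second summand suffices, elsewhere the first.\<close>
    have local: "ennreal (w x) * (\<integral>\<^sup>+y. indicator (ball 0 \<epsilon>) y * G (x - y) \<partial>lborel)
        \<le> ennreal C\<epsilon> * T x + ennreal c * wE x" if "0 < w x" for x
    proof (cases "norm x < R + \<epsilon>")
      case True
      have "(\<integral>\<^sup>+y. indicator (ball 0 \<epsilon>) y * G (x - y) \<partial>lborel) \<le> (\<integral>\<^sup>+y\<in>E. G y \<partial>lborel)"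
        unfolding E_def by (rule nn_integral_ball_reflect_le[OF G True])
      also have "\<dots> \<le> \<rho> H * A"
        unfolding A_def by (rule nn_integral_local_weight_le[OF \<rho> G H H_fin w GH E(1)])
      also have "\<dots> = ennreal c" using c by (simp add: mult.commute)
      finally have "ennreal (w x) * (\<integral>\<^sup>+y. indicator (ball 0 \<epsilon>) y * G (x - y) \<partial>lborel) \<le> ennreal (w x) * ennreal c"
        by (rule mult_left_mono) simp
      also have "\<dots> = ennreal c * wE x"
        using True that \<open>\<epsilon> > 0\<close> by (simp add: wE_def E_def mult.commute)
      finally show ?thesis by (rule order_trans) simp
    next
      case False
      have "ennreal (w x) * (\<integral>\<^sup>+y. indicator (ball 0 \<epsilon>) y * G (x - y) \<partial>lborel) \<le> ennreal C\<epsilon> * T x"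
        unfolding T_eq
      proof (rule nn_integral_ball_le[OF G H GH])
        \<comment> \<open>The growth condition is applied at the base point \<open>x - y\<close>
          with increment \<open>y\<close>. The split at \<open>R + \<epsilon>\<close> guarantees
          that this base point has norm at least \<open>R\<close>.\<close>
        fix y :: 'a assume "norm y < \<epsilon>"
        moreover from this have "R \<le> norm (x - y)"
          using False norm_triangle_ineq2[of x y] by linarith
        ultimately show "w x / w (x - y) \<le> C\<epsilon>"
          using assms(9)[rule_format, of "x - y" y] by simp
      qed (use \<open>C\<epsilon> > 0\<close> in simp)
      then show ?thesis by (rule order_trans) simp
    qed
    have "\<rho> (\<lambda>x. ennreal C\<epsilon> * T x + ennreal c * wE x) \<le> \<rho> (\<lambda>x. ennreal C\<epsilon> * T x) + \<rho> (\<lambda>x. ennreal c * wE x)"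
      by (rule banach_function_norm_add[OF \<rho>]) measurable
    also have "\<dots> = ennreal C\<epsilon> * \<rho> T + ennreal c * \<rho> wE"
      using c \<open>C\<epsilon> > 0\<close> by (simp add: banach_function_norm_cmult[OF \<rho>] TL wE)
    also have "\<dots> \<le> ennreal C\<epsilon> * (ennreal m * \<rho> H) + ennreal a * \<rho> H * ennreal b"
      using \<rho>T c a b by (intro add_mono mult_left_mono) auto
    also have "\<dots> = ennreal (C\<epsilon> * m + a * b) * \<rho> H"
      using a b m \<open>C\<epsilon> > 0\<close> by (simp add: ennreal_plus ennreal_mult distrib_left mult_ac)
    also have "\<dots> \<le> ennreal C * \<rho> H"
      unfolding C_def by (intro mult_right_mono ennreal_leI) auto
    finally have local_and_far: "\<rho> (\<lambda>x. ennreal C\<epsilon> * T x + ennreal c * wE x) \<le> ennreal C * \<rho> H" .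
    \<comment> \<open>The factor \<open>Linf_norm \<kappa>\<close> stays outside the majorant, so
      \<open>C\<close> depends on neither the kernel nor \<open>f\<close>.\<close>
    have "Yw_norm \<rho> w (conv \<kappa> f) \<le> \<rho> (\<lambda>x. ennreal (Linf_norm \<kappa>) * (ennreal C\<epsilon> * T x + ennreal c * wE x))"
      unfolding Yw_norm_def Ynorm_def
    proof (rule banach_function_norm_mono_AE[OF \<rho>])
      show "AE x in lebesgue. ennreal (cmod (conv \<kappa> f x * complex_of_real (w x)))
          \<le> ennreal (Linf_norm \<kappa>) * (ennreal C\<epsilon> * T x + ennreal c * wE x)"
        using AE_completion[OF w_pos]
      proof eventually_elim
        case (elim x)
        have "ennreal (cmod (conv \<kappa> f x * complex_of_real (w x))) = ennreal (w x) * ennreal (cmod (conv \<kappa> f x))"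
          using elim by (simp add: norm_mult ennreal_mult mult.commute)
        also have "\<dots> \<le> ennreal (w x) * (ennreal (Linf_norm \<kappa>) * (\<integral>\<^sup>+y. indicator (ball 0 \<epsilon>) y * G (x - y) \<partial>lborel))"
          unfolding G_def by (intro mult_left_mono conv_bounded_kernel(2)[OF \<kappa> supp f' f_eq]) simp
        also have "\<dots> = ennreal (Linf_norm \<kappa>) * (ennreal (w x) * (\<integral>\<^sup>+y. indicator (ball 0 \<epsilon>) y * G (x - y) \<partial>lborel))"
          by (rule mult.left_commute)
        also have "\<dots> \<le> ennreal (Linf_norm \<kappa>) * (ennreal C\<epsilon> * T x + ennreal c * wE x)"
          by (intro mult_left_mono local elim) simp
        finally show ?case .
      qed
      show "(\<lambda>x. ennreal (cmod (conv \<kappa> f x * complex_of_real (w x)))) \<in> borel_measurable lebesgue"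
        using conv_borel by measurable
    qed measurable
    also have "\<dots> = ennreal (Linf_norm \<kappa>) * \<rho> (\<lambda>x. ennreal C\<epsilon> * T x + ennreal c * wE x)"
      using AE_le_Linf_norm(1)[OF \<kappa>] by (intro banach_function_norm_cmult[OF \<rho>]) measurable
    also have "\<dots> \<le> ennreal (Linf_norm \<kappa>) * (ennreal C * \<rho> H)"
      by (rule mult_left_mono[OF local_and_far]) simp
    finally show ?thesis
      by (simp add: \<rho>H mult_ac)
  qed
  moreover have "C > 0"
    using a b m \<open>C\<epsilon> > 0\<close> unfolding C_def by (intro add_nonneg_pos add_nonneg_nonneg) auto
  ultimately show ?thesis by blast
qed

end
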